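(* Fix a mesh $\mathcal{M}$ of convex polyhedra $\{\mathfrak{m}\}$ in $\mathbb{R}^3$ and assign some ordering $\mathbf{v}_1,\ldots,\mathbf{v}_p$ to all the vertices in the mesh. Fix an associated set of generalized barycentric coordinate hat functions $\hat\lambda_1,\ldots,\hat\lambda_p$. Let $$\mathbf{u}\in\operatorname{span}\left\{\hat\lambda_i\nabla\hat\lambda_j\times\nabla\hat\lambda_k \;:\; \text{there exists } \mathfrak{m}\in\mathcal{M} \text{ such that } \mathbf{v}_i,\mathbf{v}_j,\mathbf{v}_k\in\mathfrak{m}\right\}.$$ Then $\mathbf{u}\in H(\operatorname{div},\mathcal{M})$.
   Context: Mesh: $\mathcal{M}$ is a cellular complex whose 3-dimensional cells (elements) $\mathfrak{m}$ are convex polyhedra, meeting along their lower-dimensional faces. The vertices $\mathbf{v}_i$ of the mesh are the vertices of its elements, and $\mathbf{v}_i\in\mathfrak{m}$ means that $\mathbf{v}_i$ is a vertex of $\mathfrak{m}$. Generalized barycentric coordinates on a convex polyhedron $\mathfrak{m}\subset\mathbb{R}^3$ with vertices $\{\mathbf{v}_i\}$: non-negative functions $\lambda_i:\mathfrak{m}\to\mathbb{R}$, one per vertex, such that every linear function $L:\mathfrak{m}\to\mathbb{R}$ (polynomial of degree at most 1) satisfies $L=\sum_i L(\mathbf{v}_i)\lambda_i$. One such set is chosen on each element. Hat functions: for $\mathbf{x}\in\mathfrak{m}$, $\hat\lambda_i(\mathbf{x})=\lambda_i(\mathbf{x})$ (the coordinate on $\mathfrak{m}$ associated to $\mathbf{v}_i$)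 if $\mathbf{v}_i\in\mathfrak{m}$, and $\hat\lambda_i(\mathbf{x})=0$ if $\mathbf{v}_i\notin\mathfrak{m}$. The same kind of generalized barycentric coordinates (for example Wachspress, or mean value) is chosen on polyhedra sharing a face, so that the coordinates of the two polyhedra agree on the shared face. Thus each $\hat\lambda_i$ is well defined and continuous on the mesh. The vector functions $\hat\lambda_i\nabla\hat\lambda_j\times\nabla\hat\lambda_k$ are defined piecewise, element by element. $H(\operatorname{div},\mathcal{M})$ is the space of $L^2$ vector fields on the domain covered by $\mathcal{M}$ whose (distributional) divergence is in $L^2$.
   Formalization: The generalized barycentric coordinates are additionally assumed Lipschitz on each element (hence differentiable almost everywhere with bounded gradient); without such regularity their gradients may not exist or the products may fail to be square integrable. *)

theory Defs
  imports "HOL-Analysis.Analysis" "HOL-Library.Function_Algebras"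
begin

section \<open>Meshes of convex polyhedra\<close>

definition vertices :: "(real^3) set \<Rightarrow> (real^3) set" where
  "vertices m = {w. w extreme_point_of m}"

text \<open>A mesh is given by its 3-dimensional cells; its remaining cells are the faces of these.\<close>

definition polyhedral_mesh :: "(real^3) set set \<Rightarrow> bool" where
  "polyhedral_mesh M \<longleftrightarrow>
     finite M \<and>
     (\<forall>m\<in>M. polytope m \<and> aff_dim m = 3) \<and>
     (\<forall>m\<in>M. \<forall>n\<in>M. (m \<inter> n) face_of m \<and> (m \<inter> n) face_of n)"

definition mesh_vertices :: "(real^3) set set \<Rightarrow> (real^3) set" where
  "mesh_vertices M = (\<Union>m\<in>M. vertices m)"

section \<open>Generalized barycentric coordinates and hat functions\<close>

text \<open>\<open>l w\<close> is the coordinate function associated to the vertex \<open>w\<close>; only its values on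
  \<open>m\<close>, and only for \<open>w \<in> vertices m\<close>, are constrained.\<close>

definition gen_barycentric :: "(real^3) set \<Rightarrow> (real^3 \<Rightarrow> real^3 \<Rightarrow> real) \<Rightarrow> bool" where
  "gen_barycentric m l \<longleftrightarrow>
     (\<forall>w\<in>vertices m. \<forall>x\<in>m. 0 \<le> l w x) \<and>
     (\<forall>a b. \<forall>x\<in>m. a + b \<bullet> x = (\<Sum>w\<in>vertices m. (a + b \<bullet> w) * l w x))"

text \<open>Regularity under which the products of gradients below make sense as \<open>L\<^sup>2\<close> fields: the
  coordinates are differentiable almost everywhere on the element, with bounded gradient, and
  continuous up to its boundary. For Lipschitz functions the almost everywhere
  differentiability is Rademacher's theorem, so it costs no generality.\<close>

definition regular_coordinates :: "(real^3) set \<Rightarrow> (real^3 \<Rightarrow> real^3 \<Rightarrow> real) \<Rightarrow> bool" where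
  "regular_coordinates m l \<longleftrightarrow>
     (\<forall>w\<in>vertices m.
        (\<exists>C. C-lipschitz_on m (l w)) \<and> (AE x in lebesgue_on m. l w differentiable (at x)))"

definition agree_on_shared_faces ::
    "(real^3) set set \<Rightarrow> ((real^3) set \<Rightarrow> real^3 \<Rightarrow> real^3 \<Rightarrow> real) \<Rightarrow> bool" where
  "agree_on_shared_faces M lam \<longleftrightarrow>
     (\<forall>m\<in>M. \<forall>n\<in>M. \<forall>w\<in>vertices m \<inter> vertices n. \<forall>x\<in>m \<inter> n. lam m w x = lam n w x)"

text \<open>The common value of the elementwise definitions at \<open>x\<close>; see \<open>hat_eq\<close> below for
  well-definedness. Values outside the union of the mesh are unspecified.\<close>

definition hat ::
    "(real^3) set set \<Rightarrow> ((real^3) set \<Rightarrow> real^3 \<Rightarrow> real^3 \<Rightarrow> real) \<Rightarrow> real^3 \<Rightarrow> real^3 \<Rightarrow> real" where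
  "hat M lam w x =
     (THE y. \<forall>m\<in>M. x \<in> m \<longrightarrow> y = (if w \<in> vertices m then lam m w x else 0))"

lemma gen_barycentric_zero_on_face:
  assumes m: "polytope m" and F: "F face_of m" and x: "x \<in> F"
    and l: "gen_barycentric m l" and w: "w \<in> vertices m" "w \<notin> F"
  shows "l w x = 0"
proof -
  have xm: "x \<in> m" using F x face_of_imp_subset by blast
  have fin: "finite (vertices m)"
    using m finite_polyhedron_extreme_points polytope_imp_polyhedron
    unfolding vertices_def by blast
  have "F exposed_face_of m"
    using m F exposed_face_of_polyhedron polytope_imp_polyhedron by blast
  then obtain a b where ab: "m \<subseteq> {y. a \<bullet> y \<le> b}" "F = m \<inter> {y. a \<bullet> y = b}"
    by (auto simp: exposed_face_of_def)
  have wm: "y \<in> m" if "y \<in> vertices m" for y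
    using that by (auto simp: vertices_def extreme_point_of_def)
  have lin: "c + d \<bullet> x = (\<Sum>y\<in>vertices m. (c + d \<bullet> y) * l y x)" for c d
    using l xm unfolding gen_barycentric_def by blast
  have "(\<Sum>y\<in>vertices m. (b + (- a) \<bullet> y) * l y x) = b + (- a) \<bullet> x"
    by (rule lin[symmetric])
  also have "\<dots> = 0" using x ab by auto
  finally have s: "(\<Sum>y\<in>vertices m. (b + (- a) \<bullet> y) * l y x) = 0" .
  have nn: "0 \<le> (b + (- a) \<bullet> y) * l y x" if "y \<in> vertices m" for y
    using that l xm wm[OF that] ab(1) unfolding gen_barycentric_def
    by (intro mult_nonneg_nonneg) auto
  have "(b + (- a) \<bullet> w) * l w x = 0"
    using s nn w(1) by (subst (asm) sum_nonneg_eq_0_iff[OF fin]) auto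
  moreover have "b + (- a) \<bullet> w \<noteq> 0" using w wm[OF w(1)] ab by auto
  ultimately show ?thesis by simp
qed

lemma hat_eq:
  assumes M: "polyhedral_mesh M" and l: "\<And>m. m \<in> M \<Longrightarrow> gen_barycentric m (lam m)"
    and agree: "agree_on_shared_faces M lam" and m: "m \<in> M" "x \<in> m"
  shows "hat M lam w x = (if w \<in> vertices m then lam m w x else 0)"
proof -
  have vert: "w \<in> vertices n'" if "n \<in> M" "n' \<in> M" "w \<in> vertices n" "w \<in> n \<inter> n'" for n n'
  proof -
    have *: "(n \<inter> n') face_of n" "(n \<inter> n') face_of n'"
      using M that unfolding polyhedral_mesh_def by blast+
    then have "w extreme_point_of (n \<inter> n')"
      using that extreme_point_of_face unfolding vertices_def by blast
    then show ?thesis using * extreme_point_of_face unfolding vertices_def by blast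
  qed
  have zero: "lam n w x = 0"
    if "n \<in> M" "n' \<in> M" "x \<in> n" "x \<in> n'" "w \<in> vertices n" "w \<notin> vertices n'" for n n'
  proof (rule gen_barycentric_zero_on_face)
    show "polytope n" "(n \<inter> n') face_of n"
      using that(1,2) M by (simp_all add: polyhedral_mesh_def)
    show "x \<in> n \<inter> n'" "gen_barycentric n (lam n)" "w \<in> vertices n" using that l by simp_all
    show "w \<notin> n \<inter> n'" using that vert by metis
  qed
  have "(if w \<in> vertices m then lam m w x else 0) = (if w \<in> vertices n then lam n w x else 0)"
    if "n \<in> M" "x \<in> n" for n
  proof -
    have "lam m w x = lam n w x" if "w \<in> vertices m" "w \<in> vertices n"
      using agree m \<open>n \<in> M\<close> \<open>x \<in> n\<close> that unfolding agree_on_shared_faces_def by blast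
    moreover have "lam m w x = 0" if "w \<in> vertices m" "w \<notin> vertices n"
      by (rule zero[OF m(1) \<open>n \<in> M\<close> m(2) \<open>x \<in> n\<close> that])
    moreover have "lam n w x = 0" if "w \<in> vertices n" "w \<notin> vertices m"
      by (rule zero[OF \<open>n \<in> M\<close> m(1) \<open>x \<in> n\<close> m(2) that])
    ultimately show ?thesis by presburger
  qed
  then have "\<forall>n\<in>M. x \<in> n \<longrightarrow> (if w \<in> vertices m then lam m w x else 0)
      = (if w \<in> vertices n then lam n w x else 0)" by blast
  then show ?thesis unfolding hat_def by (rule the_equality) (use m in blast)
qed

section \<open>The vector fields \<open>\<lambda>\<^sub>i \<nabla>\<lambda>\<^sub>j \<times> \<nabla>\<lambda>\<^sub>k\<close>\<close>

definition grad :: "(real^3 \<Rightarrow> real) \<Rightarrow> real^3 \<Rightarrow> real^3" where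
  "grad f x = (\<chi> i. frechet_derivative f (at x) (axis i 1))"

text \<open>In the interior of an element this depends on the coordinates of that element only, so it
  is the elementwise definition. The points on the faces of the elements, and those where a
  gradient does not exist, form a null set, on which the values are immaterial.\<close>

definition face_field ::
    "(real^3) set set \<Rightarrow> ((real^3) set \<Rightarrow> real^3 \<Rightarrow> real^3 \<Rightarrow> real)
      \<Rightarrow> real^3 \<Rightarrow> real^3 \<Rightarrow> real^3 \<Rightarrow> real^3 \<Rightarrow> real^3" where
  "face_field M lam w1 w2 w3 =
     (\<lambda>x. hat M lam w1 x *\<^sub>R cross3 (grad (hat M lam w2) x) (grad (hat M lam w3) x))"

text \<open>Linear span in the real vector space of all vector fields, with pointwise operations.\<close>

definition field_span :: "(real^3 \<Rightarrow> real^3) set \<Rightarrow> (real^3 \<Rightarrow> real^3) set" where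
  "field_span = module.span (\<lambda>(c::real) f x. c *\<^sub>R f x)"

lemma vector_space_fields: "vector_space (\<lambda>(c::real) (f :: real^3 \<Rightarrow> real^3) x. c *\<^sub>R f x)"
  by unfold_locales (auto simp: fun_eq_iff algebra_simps)

section \<open>The space \<open>H(div)\<close>\<close>

primrec Ck :: "nat \<Rightarrow> (real^3 \<Rightarrow> real) \<Rightarrow> bool" where
  "Ck 0 f \<longleftrightarrow> continuous_on UNIV f"
| "Ck (Suc k) f \<longleftrightarrow>
     (\<forall>x. f differentiable (at x)) \<and> (\<forall>h. Ck k (\<lambda>x. frechet_derivative f (at x) h))"

definition test_function :: "(real^3) set \<Rightarrow> (real^3 \<Rightarrow> real) \<Rightarrow> bool" where
  "test_function \<Omega> \<phi> \<longleftrightarrow>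
     (\<forall>k. Ck k \<phi>) \<and> compact (closure {x. \<phi> x \<noteq> 0}) \<and> closure {x. \<phi> x \<noteq> 0} \<subseteq> \<Omega>"

definition square_integrable_on :: "(real^3 \<Rightarrow> 'a::euclidean_space) \<Rightarrow> (real^3) set \<Rightarrow> bool" where
  "square_integrable_on f \<Omega> \<longleftrightarrow>
     f \<in> borel_measurable (lebesgue_on \<Omega>) \<and> integrable (lebesgue_on \<Omega>) (\<lambda>x. (norm (f x))\<^sup>2)"

definition weak_divergence :: "(real^3) set \<Rightarrow> (real^3 \<Rightarrow> real^3) \<Rightarrow> (real^3 \<Rightarrow> real) \<Rightarrow> bool" where
  "weak_divergence \<Omega> u d \<longleftrightarrow>
     (\<forall>\<phi>. test_function \<Omega> \<phi> \<longrightarrow>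
        (LINT x|lebesgue_on \<Omega>. u x \<bullet> grad \<phi> x) = - (LINT x|lebesgue_on \<Omega>. d x * \<phi> x))"

definition H_div :: "(real^3) set \<Rightarrow> (real^3 \<Rightarrow> real^3) set" where
  "H_div \<Omega> =
     {u. square_integrable_on u \<Omega> \<and> (\<exists>d. square_integrable_on d \<Omega> \<and> weak_divergence \<Omega> u d)}"

text \<open>Distributions live on the open domain covered by the mesh; the union of the (closed)
  elements differs from it by a null set.\<close>

definition mesh_domain :: "(real^3) set set \<Rightarrow> (real^3) set" where
  "mesh_domain M = interior (\<Union>M)"

end

theory Submission
  imports Defs
begin

text \<open>
  The divergence of \<open>f \<nabla>g \<times> \<nabla>h\<close> is \<open>\<nabla>f \<bullet> (\<nabla>g \<times> \<nabla>h)\<close>, also for Lipschitz \<open>f\<close>, \<open>g\<close>, \<open>h\<close>.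
  Testing with \<open>\<phi>\<close> and putting \<open>\<psi> = f \<phi>\<close>, this says that
  \<open>det (\<nabla>\<psi>, \<nabla>g, \<nabla>h)\<close> has integral zero when \<open>\<psi>\<close> has compact support. With the gradients
  replaced by difference quotients of step \<open>s\<close>, arranged as a cubical cup product, the integral is
  exactly zero by translation invariance; letting \<open>s\<close> tend to zero, dominated convergence gives the
  claim, so that neither mollification nor integration by parts on the elements is needed.
  A hat function is a valid choice of \<open>f\<close>, \<open>g\<close>, \<open>h\<close>, because a segment inside the mesh is cut by the
  finitely many elements into pieces on each of which the function is Lipschitz.
\<close>

section \<open>Integrals of Jacobian determinants\<close>

text \<open>The product of the increments of \<open>f\<close>, \<open>g\<close>, \<open>h\<close>
  along the three consecutive edges of one edge path of a parallelepiped, from \<open>x\<close> to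
  the opposite corner: the cubical cup product of \<open>df\<close>, \<open>dg\<close>,
  \<open>dh\<close> on one ordering of the edges.\<close>

definition staircase ::
    "('a::real_vector \<Rightarrow> real) \<Rightarrow> ('a \<Rightarrow> real) \<Rightarrow> ('a \<Rightarrow> real) \<Rightarrow> 'a \<Rightarrow> 'a \<Rightarrow> 'a \<Rightarrow> 'a \<Rightarrow> real" where
  "staircase f g h a b c x =
     (f (x + a) - f x) * (g (x + a + b) - g (x + a)) * (h (x + a + b + c) - h (x + a + b))"

text \<open>Antisymmetrisation over the orders of the three edges, even permutations counted
  positively. For short edges it is to leading order the determinant of the three gradients times
  the volume of the cell.\<close>

definition cup ::
    "('a::real_vector \<Rightarrow> real) \<Rightarrow> ('a \<Rightarrow> real) \<Rightarrow> ('a \<Rightarrow> real) \<Rightarrow> 'a \<Rightarrow> 'a \<Rightarrow> 'a \<Rightarrow> 'a \<Rightarrow> real" where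
  "cup f g h a b c x =
     staircase f g h a b c x + staircase f g h b c a x + staircase f g h c a b x
     - staircase f g h a c b x - staircase f g h b a c x - staircase f g h c b a x"

lemma integral_lborel_translate:
  fixes f :: "'a::euclidean_space \<Rightarrow> real"
  assumes "f \<in> borel_measurable borel"
  shows "(LINT x|lborel. f (x + c)) = (LINT x|lborel. f x)"
proof -
  have "(LINT x|lborel. f x) = (LINT x|distr lborel borel ((+) c). f x)"
    by (simp add: lborel_distr_plus)
  also have "\<dots> = (LINT x|lborel. f (c + x))"
    using assms by (intro integral_distr) auto
  finally show ?thesis by (simp add: add.commute)
qed

lemma integrable_lborel_translate:
  fixes f :: "'a::euclidean_space \<Rightarrow> real"
  assumes "integrable lborel f"
  shows "integrable lborel (\<lambda>x. f (x + c))"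
proof -
  have "integrable (distr lborel borel ((+) c)) f"
    using assms by (simp add: lborel_distr_plus)
  then have "integrable lborel (\<lambda>x. f (c + x))"
    using assms by (subst (asm) integrable_distr_eq) auto
  then show ?thesis by (simp add: add.commute)
qed

lemma integrable_mult_bounded:
  fixes f g :: "'a \<Rightarrow> real"
  assumes "integrable M f" "g \<in> borel_measurable M" "\<And>x. \<bar>g x\<bar> \<le> B"
  shows "integrable M (\<lambda>x. f x * g x)"
proof (rule Bochner_Integration.integrable_bound)
  show "integrable M (\<lambda>x. B * f x)" using assms by simp
  show "(\<lambda>x. f x * g x) \<in> borel_measurable M" using assms by measurable
  have "\<bar>f x * g x\<bar> \<le> \<bar>B * f x\<bar>" for x
    using mult_left_mono[OF order_trans[OF assms(3) abs_ge_self], of "\<bar>f x\<bar>" x]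
    by (simp add: abs_mult mult.commute)
  then show "AE x in M. norm (f x * g x) \<le> norm (B * f x)" by simp
qed

text \<open>The alternating sum over the six edge paths of a cell is the top-degree cubical cup product
  \<open>df \<union> dg \<union> dh = d (f \<union> dg \<union> dh)\<close>, so it telescopes. Translating \<open>f (x + a)\<close> to \<open>f x\<close>
  makes the total coefficient of \<open>f x\<close> vanish identically.\<close>

lemma integral_cup:
  fixes f g h :: "'a::euclidean_space \<Rightarrow> real"
  assumes f: "integrable lborel f"
    and g: "g \<in> borel_measurable borel" "\<And>x. \<bar>g x\<bar> \<le> B"
    and h: "h \<in> borel_measurable borel" "\<And>x. \<bar>h x\<bar> \<le> C"
  shows "(LINT x|lborel. cup f g h a b c x) = 0"
proof -
  \<comment> \<open>\<open>Q b c\<close> is the part of a staircase that does not involve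
    \<open>f\<close>: the staircase along \<open>a\<close>, \<open>b\<close>, \<open>c\<close> is
    the increment of \<open>f\<close> times \<open>Q b c (x + a)\<close>.\<close>
  define Q where "Q b c x = (g (x + b) - g x) * (h (x + b + c) - h (x + b))" for b c x
  note [measurable] = g(1) h(1)
  have fm [measurable]: "f \<in> borel_measurable borel" using f by auto
  have Qm [measurable]: "Q b c \<in> borel_measurable borel" for b c unfolding Q_def by measurable
  have Qb: "\<bar>Q b c x\<bar> \<le> (B + B) * (C + C)" for b c x
  proof -
    have "\<bar>g (x + b) - g x\<bar> \<le> B + B" using g(2)[of x] g(2)[of "x + b"] by linarith
    moreover have "\<bar>h (x + b + c) - h (x + b)\<bar> \<le> C + C"
      using h(2)[of "x + b + c"] h(2)[of "x + b"] by linarith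
    ultimately show ?thesis unfolding Q_def abs_mult by (intro mult_mono) auto
  qed
  have i1: "integrable lborel (\<lambda>x. f x * Q b c x)" for b c
    by (rule integrable_mult_bounded[OF f _ Qb]) simp
  have i2: "integrable lborel (\<lambda>x. f x * Q b c (x + a))" for a b c
    by (rule integrable_mult_bounded[OF f _ Qb]) simp
  have i3: "integrable lborel (\<lambda>x. f (x + a) * Q b c (x + a))" for a b c
    by (rule integrable_lborel_translate[OF i1])
  have st: "staircase f g h a b c = (\<lambda>x. f (x + a) * Q b c (x + a) - f x * Q b c (x + a))" for a b c
    by (simp add: fun_eq_iff staircase_def Q_def algebra_simps)
  have si: "integrable lborel (staircase f g h a b c)" for a b c
    unfolding st using i2 i3 by simp
  have int: "(LINT x|lborel. staircase f g h a b c x)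
      = (LINT x|lborel. f x * Q b c x) - (LINT x|lborel. f x * Q b c (x + a))" for a b c
    unfolding st using i2 i3 integral_lborel_translate[of "\<lambda>x. f x * Q b c x" a]
    by simp
  \<comment> \<open>The staircase integrand after its first term has been translated back by
    \<open>a\<close>, so that \<open>f\<close> occurs only at \<open>x\<close>.\<close>
  define R where "R a b c x = f x * Q b c x - f x * Q b c (x + a)" for a b c x
  have Ri: "integrable lborel (R a b c)" for a b c unfolding R_def using i1 i2 by simp
  have intR: "(LINT x|lborel. staircase f g h a b c x) = (LINT x|lborel. R a b c x)" for a b c
    unfolding int R_def using i1 i2 by simp
  have "(LINT x|lborel. cup f g h a b c x) = (LINT x|lborel. R a b c x + R b c a x + R c a b x
      - R a c b x - R b a c x - R c b a x)"
    unfolding cup_def using si Ri by (simp add: intR)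
  \<comment> \<open>The factor of \<open>f x\<close> is, up to sign, the coboundary of
    \<open>dg \<union> dh\<close>, hence zero at every point.\<close>
  also have "(\<lambda>x. R a b c x + R b c a x + R c a b x - R a c b x - R b a c x - R c b a x) = (\<lambda>x. 0)"
    by (simp add: fun_eq_iff R_def Q_def algebra_simps)
  finally show ?thesis by simp
qed

section \<open>Size and limit of the discrete determinant\<close>

text \<open>A nonzero staircase needs \<open>x\<close> or \<open>x + a\<close> in \<open>K\<close>.
  Its four corners then lie within \<open>3 * r\<close> of that point, so in a ball of radius
  \<open>d\<close> inside \<open>\<Omega>\<close>; balls are convex, so the three edges stay in
  \<open>\<Omega>\<close>, where the Lipschitz estimates apply.\<close>

lemma staircase_bound:
  fixes f g h :: "'a::euclidean_space \<Rightarrow> real"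
  assumes f: "\<And>p q. closed_segment p q \<subseteq> \<Omega> \<Longrightarrow> \<bar>f p - f q\<bar> \<le> A * dist p q"
    and g: "\<And>p q. closed_segment p q \<subseteq> \<Omega> \<Longrightarrow> \<bar>g p - g q\<bar> \<le> B * dist p q"
    and h: "\<And>p q. closed_segment p q \<subseteq> \<Omega> \<Longrightarrow> \<bar>h p - h q\<bar> \<le> C * dist p q"
    and f0: "\<And>x. x \<notin> K \<Longrightarrow> f x = 0"
    and K: "(\<Union>k\<in>K. ball k d) \<subseteq> \<Omega>"
    and r: "3 * r < d" "norm a = r" "norm b = r" "norm c = r"
  shows "\<bar>staircase f g h a b c x\<bar> \<le> indicator (\<Union>k\<in>K. ball k d) x * (A * B * C * r ^ 3)"
proof (cases "f (x + a) = 0 \<and> f x = 0")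
  case True
  \<comment> \<open>The staircase vanishes here, but the right-hand side must be shown nonnegative.
    The signs of \<open>A\<close>, \<open>B\<close>, \<open>C\<close> come from applying the three
    estimates to a segment of length \<open>r\<close> starting at a point of
    \<open>K\<close>.\<close>
  moreover have "0 \<le> A * B * C * r ^ 3" if x: "x \<in> (\<Union>k\<in>K. ball k d)"
  proof (cases "r = 0")
    case False
    then have r0: "0 < r" using r(2) norm_ge_zero[of a] by linarith
    obtain k where k: "k \<in> K" using x by auto
    then have "ball k d \<subseteq> \<Omega>" using K by auto
    moreover have "k \<in> ball k d" "k + a \<in> ball k d" using r r0 by (auto simp: dist_norm)
    ultimately have "closed_segment k (k + a) \<subseteq> \<Omega>"
      using closed_segment_subset[OF _ _ convex_ball] by (meson order_trans)
    from f[OF this] g[OF this] h[OF this] have "0 \<le> A * r" "0 \<le> B * r" "0 \<le> C * r"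
      using r by (auto simp: dist_norm intro: order_trans[OF abs_ge_zero])
    then show ?thesis using r0 by (simp add: zero_le_mult_iff)
  qed simp
  ultimately show ?thesis by (auto simp: staircase_def indicator_def)
next
  case False
  then obtain k where k: "k \<in> K" and "k = x \<or> k = x + a" using f0 by blast
  then have kx: "norm (k - x) \<le> r" "norm (k - (x + a)) \<le> r" using r by auto
  have r0: "0 \<le> r" using r by auto
  have dx: "dist k (x + a + b) \<le> 2 * r" "dist k (x + a + b + c) \<le> 3 * r"
    using kx norm_triangle_ineq4[of "k - (x + a)" b] norm_triangle_ineq4[of "k - (x + a)" "b + c"]
      norm_triangle_ineq[of b c] r by (auto simp: dist_norm algebra_simps)
  have b: "x \<in> ball k d" "x + a \<in> ball k d" "x + a + b \<in> ball k d" "x + a + b + c \<in> ball k d"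
    using kx dx r r0 by (auto simp: dist_norm)
  have "ball k d \<subseteq> \<Omega>" using K k by auto
  then have seg: "closed_segment p q \<subseteq> \<Omega>" if "p \<in> ball k d" "q \<in> ball k d" for p q
    using closed_segment_subset[OF that convex_ball] by auto
  have "\<bar>f (x + a) - f x\<bar> \<le> A * r" using f[OF seg[OF b(2,1)]] r by (simp add: dist_norm)
  moreover have "\<bar>g (x + a + b) - g (x + a)\<bar> \<le> B * r"
    using g[OF seg[OF b(3,2)]] r by (simp add: dist_norm)
  moreover have "\<bar>h (x + a + b + c) - h (x + a + b)\<bar> \<le> C * r"
    using h[OF seg[OF b(4,3)]] r by (simp add: dist_norm)
  ultimately have "\<bar>staircase f g h a b c x\<bar> \<le> (A * r) * (B * r) * (C * r)"
    unfolding staircase_def abs_mult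
    by (meson mult_mono mult_nonneg_nonneg abs_ge_zero order_trans)
  then show ?thesis using b k by (auto simp: indicator_def power3_eq_cube mult_ac)
qed

text \<open>Both endpoints of the increment move with \<open>n\<close>. Writing it as the increment
  from \<open>x\<close> along \<open>p + q\<close> minus the one along \<open>p\<close> fixes the
  base point, and linearity of the derivative leaves the value at \<open>q\<close>.\<close>

lemma differentiable_tendsto_quotient:
  fixes f :: "'a::real_normed_vector \<Rightarrow> real"
  assumes f: "f differentiable at x" and r: "r \<longlonglongrightarrow> 0" "\<And>n. r n \<noteq> 0"
  shows "(\<lambda>n. (f (x + r n *\<^sub>R p + r n *\<^sub>R q) - f (x + r n *\<^sub>R p)) / r n)
    \<longlonglongrightarrow> frechet_derivative f (at x) q"
proof -
  let ?D = "frechet_derivative f (at x)"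
  have D: "(f has_derivative ?D) (at x)" using f frechet_derivative_works by blast
  have *: "(\<lambda>n. (f (x + r n *\<^sub>R p) - f x) / r n) \<longlonglongrightarrow> ?D p" for p
  proof -
    have "((\<lambda>s. f (x + s *\<^sub>R p)) has_derivative (\<lambda>s. ?D (s *\<^sub>R p))) (at 0)"
      by (rule has_derivative_compose[where f="\<lambda>s. x + s *\<^sub>R p"])
        (use D in \<open>auto intro!: derivative_eq_intros\<close>)
    then have "((\<lambda>s. f (x + s *\<^sub>R p)) has_field_derivative ?D p) (at 0)"
      using linear_frechet_derivative[OF f]
      by (simp add: has_field_derivative_def linear_cmul mult.commute[of _ "?D p"])
    then have "((\<lambda>s. (f (x + s *\<^sub>R p) - f x) / s) \<longlongrightarrow> ?D p) (at 0)"
      by (simp add: DERIV_def)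
    then show ?thesis
      by (rule filterlim_compose) (use r in \<open>auto simp: filterlim_at\<close>)
  qed
  have "(\<lambda>n. (f (x + r n *\<^sub>R (p + q)) - f x) / r n - (f (x + r n *\<^sub>R p) - f x) / r n)
     \<longlonglongrightarrow> ?D (p + q) - ?D p"
    by (intro tendsto_diff *)
  moreover have "?D (p + q) - ?D p = ?D q"
    using linear_frechet_derivative[OF f] by (simp add: linear_add)
  ultimately show ?thesis by (simp add: diff_divide_distrib[symmetric] algebra_simps)
qed

lemma staircase_tendsto:
  fixes f g h :: "'a::real_normed_vector \<Rightarrow> real"
  assumes "f differentiable at x" "g differentiable at x" "h differentiable at x"
    and r: "r \<longlonglongrightarrow> 0" "\<And>n. r n \<noteq> 0"
  shows "(\<lambda>n. staircase f g h (r n *\<^sub>R a) (r n *\<^sub>R b) (r n *\<^sub>R c) x / r n ^ 3)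
    \<longlonglongrightarrow> frechet_derivative f (at x) a * frechet_derivative g (at x) b * frechet_derivative h (at x) c"
proof -
  \<comment> \<open>The shifts \<open>0\<close>, \<open>a\<close> and \<open>a + b\<close> are the
    starting points of the three edges, relative to \<open>x\<close> and before scaling.\<close>
  have "(\<lambda>n. (f (x + r n *\<^sub>R 0 + r n *\<^sub>R a) - f (x + r n *\<^sub>R 0)) / r n
       * ((g (x + r n *\<^sub>R a + r n *\<^sub>R b) - g (x + r n *\<^sub>R a)) / r n)
       * ((h (x + r n *\<^sub>R (a + b) + r n *\<^sub>R c) - h (x + r n *\<^sub>R (a + b))) / r n))
    \<longlonglongrightarrow> frechet_derivative f (at x) a * frechet_derivative g (at x) b * frechet_derivative h (at x) c"
    by (intro tendsto_mult differentiable_tendsto_quotient assms)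
  then show ?thesis
    by (simp add: staircase_def power3_eq_cube scaleR_add_right add.assoc)
qed

text \<open>Division by the volume \<open>r n ^ 3\<close> of the cube turns the six staircases into
  the six terms of the Leibniz expansion of the triple product.\<close>

lemma cup_tendsto:
  assumes "f differentiable at x" "g differentiable at x" "h differentiable at x"
    and r: "r \<longlonglongrightarrow> 0" "\<And>n. r n \<noteq> 0"
  shows "(\<lambda>n. cup f g h (r n *\<^sub>R axis 1 1) (r n *\<^sub>R axis 2 1) (r n *\<^sub>R axis 3 1) x / r n ^ 3)
    \<longlonglongrightarrow> grad f x \<bullet> cross3 (grad g x) (grad h x)"
proof -
  have "grad f x \<bullet> cross3 (grad g x) (grad h x) =
     grad f x $ 1 * grad g x $ 2 * grad h x $ 3 + grad f x $ 2 * grad g x $ 3 * grad h x $ 1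
     + grad f x $ 3 * grad g x $ 1 * grad h x $ 2 - grad f x $ 1 * grad g x $ 3 * grad h x $ 2
     - grad f x $ 2 * grad g x $ 1 * grad h x $ 3 - grad f x $ 3 * grad g x $ 2 * grad h x $ 1"
    by (simp add: cross3_simps)
  also have "(\<lambda>n. cup f g h (r n *\<^sub>R axis 1 1) (r n *\<^sub>R axis 2 1) (r n *\<^sub>R axis 3 1) x / r n ^ 3)
    \<longlonglongrightarrow> \<dots>"
    unfolding cup_def diff_divide_distrib add_divide_distrib grad_def vec_lambda_beta
    by (intro tendsto_intros staircase_tendsto assms)
  finally show ?thesis .
qed

text \<open>The domain need not be convex, so only differences along segments inside it are controlled.\<close>

definition admissible :: "(real^3) set \<Rightarrow> (real^3 \<Rightarrow> real) \<Rightarrow> bool" where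
  "admissible \<Omega> g \<longleftrightarrow> g \<in> borel_measurable borel \<and> (\<exists>B. \<forall>x. \<bar>g x\<bar> \<le> B) \<and>
     (\<exists>L. \<forall>p q. closed_segment p q \<subseteq> \<Omega> \<longrightarrow> \<bar>g p - g q\<bar> \<le> L * dist p q) \<and>
     (AE x in lebesgue. x \<in> \<Omega> \<longrightarrow> g differentiable at x)"

section \<open>Passage to the limit in the discrete identity\<close>

text \<open>Lebesgue measure is complete, so a function that equals the measurable pointwise
  \<open>lim\<close> almost everywhere is measurable. This makes gradients and Jacobians, known only
  as almost everywhere limits, measurable.\<close>

lemma borel_measurable_AE_LIMSEQ:
  fixes f :: "'a::euclidean_space \<Rightarrow> real"
  assumes "\<And>n. u n \<in> borel_measurable lebesgue" and "AE x in lebesgue. (\<lambda>n. u n x) \<longlonglongrightarrow> f x"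
  shows "f \<in> borel_measurable lebesgue"
proof (rule borel_measurable_AE)
  show "(\<lambda>x. lim (\<lambda>n. u n x)) \<in> borel_measurable lebesgue"
    using assms(1) by (rule borel_measurable_lim_metric)
  show "AE x in lebesgue. lim (\<lambda>n. u n x) = f x"
    using assms(2) by eventually_elim (rule limI)
qed

text \<open>The scaled cup products have integral zero on the whole space, converge to the Jacobian
  almost everywhere in \<open>\<Omega>\<close>, and are dominated by a constant on the
  \<open>d\<close>-neighbourhood of \<open>K\<close>, outside which they vanish.\<close>

lemma integral_jacobian_zero:
  assumes "open \<Omega>" and K: "compact K" "K \<subseteq> \<Omega>" "\<And>x. x \<notin> K \<Longrightarrow> f x = 0"
    and adm: "admissible \<Omega> f" "admissible \<Omega> g" "admissible \<Omega> h"
  shows "(LINT x|lebesgue_on \<Omega>. grad f x \<bullet> cross3 (grad g x) (grad h x)) = 0"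
proof -
  obtain d where d: "d > 0" "(\<Union>k\<in>K. ball k d) \<subseteq> \<Omega>"
    using compact_subset_open_imp_ball_epsilon_subset[OF K(1) \<open>open \<Omega>\<close> K(2)] by blast
  obtain A B C where
    A: "\<And>p q. closed_segment p q \<subseteq> \<Omega> \<Longrightarrow> \<bar>f p - f q\<bar> \<le> A * dist p q" and
    B: "\<And>p q. closed_segment p q \<subseteq> \<Omega> \<Longrightarrow> \<bar>g p - g q\<bar> \<le> B * dist p q" and
    C: "\<And>p q. closed_segment p q \<subseteq> \<Omega> \<Longrightarrow> \<bar>h p - h q\<bar> \<le> C * dist p q"
    using adm unfolding admissible_def by metis
  obtain F G H where F: "\<And>x. \<bar>f x\<bar> \<le> F" and G: "\<And>x. \<bar>g x\<bar> \<le> G" and H: "\<And>x. \<bar>h x\<bar> \<le> H"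
    using adm unfolding admissible_def by metis
  have [measurable]: "f \<in> borel_measurable borel" "g \<in> borel_measurable borel"
    "h \<in> borel_measurable borel" using adm by (auto simp: admissible_def)
  let ?U = "\<Union>k\<in>K. ball k d"
  \<comment> \<open>Extension by zero, since the discrete identity rests on translations of the
    whole space.\<close>
  define J where "J x = indicator \<Omega> x * (grad f x \<bullet> cross3 (grad g x) (grad h x))" for x
  \<comment> \<open>The offset 4 gives \<open>3 * r n < d\<close> from \<open>n = 0\<close> on, as
    the staircase bound requires.\<close>
  define r where "r n = d / real (n + 4)" for n
  define c where "c n x = cup f g h (r n *\<^sub>R axis 1 1) (r n *\<^sub>R axis 2 1) (r n *\<^sub>R axis 3 1) x / r n ^ 3" for n x
  have r: "r n > 0" "3 * r n < d" for n
    using d(1) by (auto simp: r_def field_simps intro: add_pos_nonneg)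
  have r0: "r \<longlonglongrightarrow> 0" unfolding r_def
    by (rule LIMSEQ_ignore_initial_segment[OF lim_const_over_n])
  have cm [measurable]: "c n \<in> borel_measurable borel" for n
    unfolding c_def cup_def staircase_def by measurable
  \<comment> \<open>Each of the six staircases contributes \<open>A * B * C * r n ^ 3\<close>; the
    power cancels, so the bound does not depend on \<open>n\<close>.\<close>
  have cb: "\<bar>c n x\<bar> \<le> indicator ?U x * (6 * (A * B * C))" for n x
  proof -
    have "\<bar>cup f g h (r n *\<^sub>R axis 1 1) (r n *\<^sub>R axis 2 1) (r n *\<^sub>R axis 3 1) x\<bar>
        \<le> 6 * (indicator ?U x * (A * B * C * r n ^ 3))"
    proof -
      have "\<bar>staircase f g h p q s x\<bar> \<le> indicator ?U x * (A * B * C * r n ^ 3)"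
        if "norm p = r n" "norm q = r n" "norm s = r n" for p q s
        by (rule staircase_bound[OF A B C K(3) d(2) r(2)[of n] that])
      moreover have "norm (r n *\<^sub>R axis i 1 :: real^3) = r n" for i using r(1)[of n] by simp
      ultimately have s: "\<bar>staircase f g h (r n *\<^sub>R axis i 1) (r n *\<^sub>R axis j 1) (r n *\<^sub>R axis k 1) x\<bar>
          \<le> indicator ?U x * (A * B * C * r n ^ 3)" for i j k by blast
      show ?thesis
        unfolding cup_def using s[of 1 2 3] s[of 2 3 1] s[of 3 1 2] s[of 1 3 2] s[of 2 1 3] s[of 3 2 1]
        by linarith
    qed
    then show ?thesis using r(1)[of n] unfolding c_def
      by (simp add: divide_simps abs_mult mult_ac)
  qed
  have lim: "AE x in lebesgue. (\<lambda>n. c n x) \<longlonglongrightarrow> J x"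
  proof -
    have "AE x in lebesgue. x \<in> \<Omega> \<longrightarrow> f differentiable at x \<and> g differentiable at x \<and> h differentiable at x"
      using adm by (auto simp: admissible_def AE_conj_iff elim: eventually_elim2)
    then show ?thesis
    proof eventually_elim
      case (elim x)
      show ?case
      proof (cases "x \<in> \<Omega>")
        case True
        then show ?thesis unfolding c_def J_def using elim r0 r(1)
          by (simp add: cup_tendsto less_imp_neq[symmetric])
      next
        case False
        \<comment> \<open>Off \<open>\<Omega>\<close> nothing is known about derivatives, but there
          the dominating function is zero, so the whole sequence is.\<close>
        then have "x \<notin> ?U" using d(2) by blast
        then have "indicator ?U x = (0::real)" by (rule indicator_simps)
        then have "c n x = 0" for n using cb[of n x] by simp
        then show ?thesis using False by (simp add: J_def)
      qed
    qed
  qed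
  have cl: "c n \<in> borel_measurable lebesgue" for n using cm by (simp add: measurable_completion)
  have Jm: "J \<in> borel_measurable lebesgue" by (rule borel_measurable_AE_LIMSEQ[OF cl lim])
  have bU: "bounded ?U"
  proof -
    obtain R where R: "\<And>k. k \<in> K \<Longrightarrow> norm k \<le> R" using compact_imp_bounded[OF K(1)] bounded_iff by metis
    have "norm x \<le> R + d" if x: "x \<in> ?U" for x
    proof -
      obtain k where "k \<in> K" "dist k x < d" using x by auto
      then show ?thesis using R[of k] norm_triangle_ineq2[of x k] by (simp add: dist_norm norm_minus_commute)
    qed
    then show ?thesis by (meson bounded_iff)
  qed
  have U: "?U \<in> lmeasurable" using bU by (intro lmeasurable_open open_UN) auto
  have wi: "integrable lebesgue (\<lambda>x. indicator ?U x * (6 * (A * B * C)))"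
    using U by (intro integrable_mult_left integrable_real_indicator) (auto simp: fmeasurable_def)
  \<comment> \<open>Bounded and zero outside a compact set, \<open>f\<close> can serve as the
    integrable factor of \<open>integral_cup\<close>.\<close>
  have fi: "integrable lborel f"
  proof (rule Bochner_Integration.integrable_bound)
    show "integrable lborel (\<lambda>x. indicator K x * F)"
      using K(1)
      by (intro integrable_mult_left integrable_real_indicator)
        (use emeasure_bounded_finite[OF compact_imp_bounded] in \<open>auto intro: borel_compact\<close>)
    show "AE x in lborel. norm (f x) \<le> norm (indicator K x * F)"
      using order_trans[OF F abs_ge_self] K(3) by (intro AE_I2) (auto simp: indicator_def)
  qed simp
  have c0: "(LINT x|lebesgue. c n x) = 0" for n
  proof -
    have "(LINT x|lborel. cup f g h (r n *\<^sub>R axis 1 1) (r n *\<^sub>R axis 2 1) (r n *\<^sub>R axis 3 1) x) = 0"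
      by (rule integral_cup[where B=G and C=H]) (use fi G H in auto)
    moreover have "c n \<in> borel_measurable lborel" using cm by simp
    ultimately show ?thesis by (subst integral_completion) (simp_all add: c_def[abs_def])
  qed
  have "(\<lambda>n. LINT x|lebesgue. c n x) \<longlonglongrightarrow> (LINT x|lebesgue. J x)"
    by (rule integral_dominated_convergence[OF Jm cl wi lim]) (use cb in simp)
  then have "(LINT x|lebesgue. J x) = 0" unfolding c0 using LIMSEQ_unique tendsto_const by blast
  then show ?thesis using \<open>open \<Omega>\<close> by (simp add: J_def[abs_def] integral_restrict_space)
qed

section \<open>Weak divergence\<close>

lemma square_integrable_on_bounded:
  fixes f :: "real^3 \<Rightarrow> 'a::euclidean_space"
  assumes \<Omega>: "\<Omega> \<in> lmeasurable" and f: "f \<in> borel_measurable (lebesgue_on \<Omega>)"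
    and B: "AE x in lebesgue_on \<Omega>. norm (f x) \<le> B"
  shows "square_integrable_on f \<Omega>"
  unfolding square_integrable_on_def
proof
  interpret finite_measure "lebesgue_on \<Omega>" by (rule finite_measure_lebesgue_on[OF \<Omega>])
  show "integrable (lebesgue_on \<Omega>) (\<lambda>x. (norm (f x))\<^sup>2)"
  proof (rule integrable_const_bound)
    show "AE x in lebesgue_on \<Omega>. norm ((norm (f x))\<^sup>2) \<le> B\<^sup>2"
      using B by eventually_elim (simp add: power_mono)
  qed (use f in measurable)
qed fact

lemma square_integrable_on_inner:
  fixes f g :: "real^3 \<Rightarrow> 'a::euclidean_space"
  assumes f: "square_integrable_on f \<Omega>" and g: "square_integrable_on g \<Omega>"
  shows "integrable (lebesgue_on \<Omega>) (\<lambda>x. f x \<bullet> g x)"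
proof (rule Bochner_Integration.integrable_bound)
  show "integrable (lebesgue_on \<Omega>) (\<lambda>x. (norm (f x))\<^sup>2 + (norm (g x))\<^sup>2)"
    using f g unfolding square_integrable_on_def by (intro Bochner_Integration.integrable_add) auto
  show "(\<lambda>x. f x \<bullet> g x) \<in> borel_measurable (lebesgue_on \<Omega>)"
    using f g unfolding square_integrable_on_def by (intro borel_measurable_inner) auto
  have "\<bar>f x \<bullet> g x\<bar> \<le> (norm (f x))\<^sup>2 + (norm (g x))\<^sup>2" for x
  proof -
    have "\<bar>f x \<bullet> g x\<bar> \<le> norm (f x) * norm (g x)" by (rule Cauchy_Schwarz_ineq2)
    also have "\<dots> \<le> (norm (f x))\<^sup>2 + (norm (g x))\<^sup>2"
      using sum_squares_bound[of "norm (f x)" "norm (g x)"] mult_nonneg_nonneg[OF norm_ge_zero norm_ge_zero, of "f x" "g x"]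
      by linarith
    finally show ?thesis .
  qed
  then show "AE x in lebesgue_on \<Omega>. norm (f x \<bullet> g x) \<le> norm ((norm (f x))\<^sup>2 + (norm (g x))\<^sup>2)"
    by simp
qed

lemma square_integrable_on_add:
  fixes f g :: "real^3 \<Rightarrow> 'a::euclidean_space"
  assumes f: "square_integrable_on f \<Omega>" and g: "square_integrable_on g \<Omega>"
  shows "square_integrable_on (\<lambda>x. f x + g x) \<Omega>"
  unfolding square_integrable_on_def
proof
  show "(\<lambda>x. f x + g x) \<in> borel_measurable (lebesgue_on \<Omega>)"
    using f g unfolding square_integrable_on_def by (intro borel_measurable_add) auto
  have "integrable (lebesgue_on \<Omega>) (\<lambda>x. f x \<bullet> f x + 2 * (f x \<bullet> g x) + g x \<bullet> g x)"
    using f g by (intro Bochner_Integration.integrable_add integrable_mult_right square_integrable_on_inner)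
  then show "integrable (lebesgue_on \<Omega>) (\<lambda>x. (norm (f x + g x))\<^sup>2)"
    by (simp add: power2_norm_eq_inner inner_add inner_commute algebra_simps)
qed

lemma square_integrable_on_scaleR:
  fixes f :: "real^3 \<Rightarrow> 'a::euclidean_space"
  assumes "square_integrable_on f \<Omega>"
  shows "square_integrable_on (\<lambda>x. c *\<^sub>R f x) \<Omega>"
  using assms unfolding square_integrable_on_def
  by (auto simp: power_mult_distrib intro!: borel_measurable_scaleR)

section \<open>Gradients and test functions\<close>

lemma test_function_Ck: "test_function \<Omega> \<phi> \<Longrightarrow> Ck k \<phi>"
  by (simp add: test_function_def)

lemma
  assumes "test_function \<Omega> \<phi>"
  shows test_function_differentiable: "\<phi> differentiable at x"
    and continuous_on_grad_test_function: "continuous_on UNIV (grad \<phi>)"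
    and continuous_on_test_function: "continuous_on UNIV \<phi>"
  using test_function_Ck[OF assms, of "Suc 0"] test_function_Ck[OF assms, of 0]
  by (auto simp: grad_def[abs_def] intro!: continuous_intros)

lemma frechet_derivative_eq_grad:
  assumes "f differentiable at x"
  shows "frechet_derivative f (at x) h = grad f x \<bullet> h"
proof -
  let ?D = "frechet_derivative f (at x)"
  note lin = linear_frechet_derivative[OF assms]
  have "?D h = ?D (\<Sum>i\<in>UNIV. h $ i *\<^sub>R axis i 1)"
    by (simp add: basis_expansion flip: scalar_mult_eq_scaleR)
  also have "\<dots> = (\<Sum>i\<in>UNIV. h $ i * ?D (axis i 1))"
    using lin by (simp add: linear_sum linear_cmul)
  finally show ?thesis by (simp add: inner_vec_def grad_def mult.commute)
qed

lemma has_derivative_grad: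
  assumes "f differentiable at x"
  shows "(f has_derivative (\<lambda>h. grad f x \<bullet> h)) (at x)"
proof -
  have "frechet_derivative f (at x) = (\<lambda>h. grad f x \<bullet> h)"
    using frechet_derivative_eq_grad[OF assms] by blast
  then show ?thesis using assms frechet_derivative_works by metis
qed

lemma grad_eqI:
  assumes "(f has_derivative (\<lambda>h. d \<bullet> h)) (at x)"
  shows "grad f x = d"
  using frechet_derivative_at[OF assms, symmetric] by (simp add: grad_def vec_eq_iff inner_axis)

lemma grad_mult:
  assumes "f differentiable at x" "g differentiable at x"
  shows "grad (\<lambda>x. f x * g x) x = f x *\<^sub>R grad g x + g x *\<^sub>R grad f x"
proof (rule grad_eqI)
  show "((\<lambda>x. f x * g x) has_derivative (\<lambda>h. (f x *\<^sub>R grad g x + g x *\<^sub>R grad f x) \<bullet> h)) (at x)"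
    by (rule has_derivative_eq_rhs[OF has_derivative_mult[OF has_derivative_grad[OF assms(1)] has_derivative_grad[OF assms(2)]]])
       (simp add: fun_eq_iff inner_add_left algebra_simps)
qed

text \<open>Functions that agree near \<open>x\<close> have the same derivatives there. As
  \<open>frechet_derivative\<close> is a choice among these, the equality also covers points without
  a derivative, where the value is arbitrary.\<close>

lemma grad_transform:
  assumes "open S" "x \<in> S" "\<And>y. y \<in> S \<Longrightarrow> f y = g y"
  shows "grad f x = grad g x"
proof -
  have "(f has_derivative D) (at x) \<longleftrightarrow> (g has_derivative D) (at x)" for D
    using has_derivative_transform_within_open[OF _ assms(1,2)] assms(3) by metis
  then show ?thesis by (simp add: grad_def frechet_derivative_def)
qed

lemma test_function_support:
  assumes "test_function \<Omega> \<phi>"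
  obtains K where "compact K" "K \<subseteq> \<Omega>" "\<And>x. x \<notin> K \<Longrightarrow> \<phi> x = 0" "\<And>x. x \<notin> K \<Longrightarrow> grad \<phi> x = 0"
proof (rule that[of "closure {x. \<phi> x \<noteq> 0}"])
  let ?K = "closure {x. \<phi> x \<noteq> 0}"
  show "compact ?K" "?K \<subseteq> \<Omega>" using assms by (auto simp: test_function_def)
  show z: "\<phi> x = 0" if "x \<notin> ?K" for x using that closure_subset[of "{x. \<phi> x \<noteq> 0}"] by blast
  \<comment> \<open>The complement of the support is open and \<open>\<phi>\<close> is zero on it,
    so its gradient agrees with that of a constant.\<close>
  show "grad \<phi> x = 0" if "x \<notin> ?K" for x
  proof -
    have "grad \<phi> x = grad (\<lambda>x. 0) x"
    proof (rule grad_transform)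
      show "open (- ?K)" by (rule open_Compl) (rule closed_closure)
      show "x \<in> - ?K" using that by simp
    qed (rule z[OF ComplD])
    also have "\<dots> = 0" by (simp add: grad_def vec_eq_iff)
    finally show ?thesis .
  qed
qed

lemma bounded_if_compact_support:
  fixes f :: "'a::topological_space \<Rightarrow> 'b::real_normed_vector"
  assumes "compact K" "continuous_on UNIV f" "\<And>x. x \<notin> K \<Longrightarrow> f x = 0"
  obtains B where "\<And>x. norm (f x) \<le> B"
proof -
  have "bounded (f ` K)"
    using assms continuous_on_subset compact_continuous_image compact_imp_bounded by blast
  then obtain B where B: "B > 0" "\<And>x. x \<in> K \<Longrightarrow> norm (f x) \<le> B"
    by (auto simp: bounded_pos)
  have "norm (f x) \<le> B" for x using B assms(3)[of x] by (cases "x \<in> K") auto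
  then show ?thesis by (rule that)
qed

lemma
  assumes "test_function \<Omega> \<phi>" "\<Omega> \<in> lmeasurable"
  shows square_integrable_on_test_function: "square_integrable_on \<phi> \<Omega>"
    and square_integrable_on_grad_test_function: "square_integrable_on (grad \<phi>) \<Omega>"
proof -
  obtain K where K: "compact K" "\<And>x. x \<notin> K \<Longrightarrow> \<phi> x = 0" "\<And>x. x \<notin> K \<Longrightarrow> grad \<phi> x = 0"
    using test_function_support[OF assms(1)] by metis
  have *: "square_integrable_on f \<Omega>" if f: "continuous_on UNIV f" "\<And>x. x \<notin> K \<Longrightarrow> f x = 0"
    for f :: "real^3 \<Rightarrow> 'a::euclidean_space"
  proof -
    obtain B where "\<And>x. norm (f x) \<le> B" by (rule bounded_if_compact_support[OF K(1) f]) auto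
    moreover have "f \<in> borel_measurable (lebesgue_on \<Omega>)"
      using f(1) by (simp add: borel_measurable_continuous_onI measurable_completion measurable_restrict_space1)
    ultimately show ?thesis using square_integrable_on_bounded[OF assms(2)] by blast
  qed
  show "square_integrable_on \<phi> \<Omega>" using * continuous_on_test_function[OF assms(1)] K by blast
  obtain B where B: "\<And>x. norm (grad \<phi> x) \<le> B"
    by (rule bounded_if_compact_support[OF K(1) continuous_on_grad_test_function[OF assms(1)] K(3)]) auto
  moreover have "grad \<phi> \<in> borel_measurable (lebesgue_on \<Omega>)"
    using continuous_on_grad_test_function[OF assms(1)]
    by (simp add: borel_measurable_continuous_onI measurable_completion measurable_restrict_space1)
  ultimately show "square_integrable_on (grad \<phi>) \<Omega>"
    using square_integrable_on_bounded[OF assms(2)] by blast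
qed

section \<open>Admissible functions and their gradients\<close>

text \<open>The gradient is continuous with compact support, hence bounded, and the mean value
  inequality on the convex set \<open>UNIV\<close> gives a global Lipschitz constant.\<close>

lemma admissible_test_function:
  assumes "test_function \<Omega> \<phi>"
  shows "admissible \<Omega> \<phi>"
  unfolding admissible_def
proof (intro conjI)
  obtain K where K: "compact K" "\<And>x. x \<notin> K \<Longrightarrow> \<phi> x = 0" "\<And>x. x \<notin> K \<Longrightarrow> grad \<phi> x = 0"
    using test_function_support[OF assms] by metis
  show "\<phi> \<in> borel_measurable borel"
    using continuous_on_test_function[OF assms] by (rule borel_measurable_continuous_onI)
  obtain B where "\<And>x. norm (\<phi> x) \<le> B"
    by (rule bounded_if_compact_support[OF K(1) continuous_on_test_function[OF assms] K(2)]) auto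
  then show "\<exists>B. \<forall>x. \<bar>\<phi> x\<bar> \<le> B" by auto
  obtain L where L: "\<And>x. norm (grad \<phi> x) \<le> L"
    by (rule bounded_if_compact_support[OF K(1) continuous_on_grad_test_function[OF assms] K(3)]) auto
  have "L-lipschitz_on UNIV \<phi>"
  proof (rule bounded_derivative_imp_lipschitz)
    show "(\<phi> has_derivative (\<lambda>h. grad \<phi> x \<bullet> h)) (at x within UNIV)" for x
      using has_derivative_grad[OF test_function_differentiable[OF assms]] .
    show "onorm (\<lambda>h. grad \<phi> x \<bullet> h) \<le> L" for x
    proof (rule onorm_bound)
      show "norm (grad \<phi> x \<bullet> h) \<le> L * norm h" for h
        using order_trans[OF Cauchy_Schwarz_ineq2 mult_right_mono[OF L norm_ge_zero]] by simp
    qed (rule order_trans[OF norm_ge_zero L])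
    show "0 \<le> L" using order_trans[OF norm_ge_zero L] .
  qed simp
  then have "\<bar>\<phi> p - \<phi> q\<bar> \<le> L * dist p q" for p q
    using lipschitz_onD[of L UNIV \<phi> p q] by (simp add: dist_real_def)
  then show "\<exists>L. \<forall>p q. closed_segment p q \<subseteq> \<Omega> \<longrightarrow> \<bar>\<phi> p - \<phi> q\<bar> \<le> L * dist p q" by blast
  show "AE x in lebesgue. x \<in> \<Omega> \<longrightarrow> \<phi> differentiable at x"
    using test_function_differentiable[OF assms] by simp
qed

text \<open>Needed for the product of \<open>f\<close> with a test function. Boundedness of both
  factors is what carries the Lipschitz estimate over to the product.\<close>

lemma admissible_mult:
  assumes f: "admissible \<Omega> f" and g: "admissible \<Omega> g"
  shows "admissible \<Omega> (\<lambda>x. f x * g x)"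
  unfolding admissible_def
proof (intro conjI)
  show "(\<lambda>x. f x * g x) \<in> borel_measurable borel"
    using f g unfolding admissible_def by (intro borel_measurable_times) auto
  obtain F G A B where F: "\<And>x. \<bar>f x\<bar> \<le> F" and G: "\<And>x. \<bar>g x\<bar> \<le> G"
    and A: "\<And>p q. closed_segment p q \<subseteq> \<Omega> \<Longrightarrow> \<bar>f p - f q\<bar> \<le> A * dist p q"
    and B: "\<And>p q. closed_segment p q \<subseteq> \<Omega> \<Longrightarrow> \<bar>g p - g q\<bar> \<le> B * dist p q"
    using f g unfolding admissible_def by metis
  have F0: "0 \<le> F" using F[of 0] by linarith
  have G0: "0 \<le> G" using G[of 0] by linarith
  have "\<bar>f x * g x\<bar> \<le> F * G" for x
    unfolding abs_mult by (intro mult_mono F G F0) simp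
  then show "\<exists>B. \<forall>x. \<bar>f x * g x\<bar> \<le> B" by blast
  have "\<bar>f p * g p - f q * g q\<bar> \<le> (F * B + G * A) * dist p q" if s: "closed_segment p q \<subseteq> \<Omega>" for p q
  proof -
    have "f p * g p - f q * g q = f p * (g p - g q) + g q * (f p - f q)" by algebra
    then have "\<bar>f p * g p - f q * g q\<bar> \<le> \<bar>f p\<bar> * \<bar>g p - g q\<bar> + \<bar>g q\<bar> * \<bar>f p - f q\<bar>"
      by (metis abs_mult abs_triangle_ineq)
    also have "\<dots> \<le> F * (B * dist p q) + G * (A * dist p q)"
      by (intro add_mono mult_mono F G A B s F0 G0) auto
    finally show ?thesis by (simp add: algebra_simps)
  qed
  then show "\<exists>L. \<forall>p q. closed_segment p q \<subseteq> \<Omega> \<longrightarrow> \<bar>f p * g p - f q * g q\<bar> \<le> L * dist p q" by blast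
  have "AE x in lebesgue. x \<in> \<Omega> \<longrightarrow> f differentiable at x"
    "AE x in lebesgue. x \<in> \<Omega> \<longrightarrow> g differentiable at x" using f g by (auto simp: admissible_def)
  then show "AE x in lebesgue. x \<in> \<Omega> \<longrightarrow> (\<lambda>x. f x * g x) differentiable at x"
    by eventually_elim auto
qed

lemma grad_quotient_tendsto:
  assumes "f differentiable at x"
  shows "(\<lambda>n. (f (x + inverse (real (Suc n)) *\<^sub>R axis i 1) - f x) / inverse (real (Suc n))) \<longlonglongrightarrow> grad f x $ i"
  using differentiable_tendsto_quotient[OF assms LIMSEQ_inverse_real_of_nat, of 0 "axis i 1"]
  by (simp add: grad_def del: of_nat_Suc)

text \<open>The components are almost everywhere limits of forward difference quotients. These are
  Borel on the whole space, even where the shifted point leaves \<open>\<Omega>\<close>.\<close>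

lemma admissible_grad_measurable:
  assumes g: "admissible \<Omega> g" and "open \<Omega>"
  shows "grad g \<in> borel_measurable (lebesgue_on \<Omega>)"
proof -
  have "(\<lambda>x. indicator \<Omega> x * grad g x $ i) \<in> borel_measurable lebesgue" for i
  proof (rule borel_measurable_AE_LIMSEQ)
    have [measurable]: "g \<in> borel_measurable borel" "\<Omega> \<in> sets borel"
      using g \<open>open \<Omega>\<close> by (auto simp: admissible_def)
    show "(\<lambda>x. indicator \<Omega> x * ((g (x + inverse (real (Suc n)) *\<^sub>R axis i 1) - g x) / inverse (real (Suc n))))
        \<in> borel_measurable lebesgue" for n
      by (rule measurable_completion) measurable
    have "AE x in lebesgue. x \<in> \<Omega> \<longrightarrow> g differentiable at x" using g by (simp add: admissible_def)
    then show "AE x in lebesgue. (\<lambda>n. indicator \<Omega> x * ((g (x + inverse (real (Suc n)) *\<^sub>R axis i 1) - g x) / inverse (real (Suc n))))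
        \<longlonglongrightarrow> indicator \<Omega> x * grad g x $ i"
      by eventually_elim (use grad_quotient_tendsto in \<open>auto simp: indicator_def simp del: of_nat_Suc\<close>)
  qed
  then have "(\<lambda>x. grad g x $ i) \<in> borel_measurable (lebesgue_on \<Omega>)" for i
    using \<open>open \<Omega>\<close> by (subst borel_measurable_restrict_space_iff) auto
  then show ?thesis
    by (subst borel_measurable_euclidean_space) (auto simp: Basis_vec_def inner_axis)
qed

text \<open>Short coordinate segments from a point of the open set \<open>\<Omega>\<close> remain in
  a ball inside it, so the Lipschitz constant bounds each difference quotient and hence each partial
  derivative; the norm is at most the sum of the three.\<close>

lemma admissible_grad_bounded:
  assumes g: "admissible \<Omega> g" and "open \<Omega>"
  obtains B where "AE x in lebesgue. x \<in> \<Omega> \<longrightarrow> norm (grad g x) \<le> B"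
proof -
  obtain L where L: "\<And>p q. closed_segment p q \<subseteq> \<Omega> \<Longrightarrow> \<bar>g p - g q\<bar> \<le> L * dist p q"
    using g unfolding admissible_def by metis
  have bound: "\<bar>grad g x $ i\<bar> \<le> L" if x: "x \<in> \<Omega>" "g differentiable at x" for x i
  proof (rule tendsto_upperbound[OF tendsto_rabs[OF grad_quotient_tendsto[OF x(2)]]])
    obtain e where e: "e > 0" "ball x e \<subseteq> \<Omega>" using \<open>open \<Omega>\<close> x(1) openE by blast
    have "eventually (\<lambda>n. inverse (real (Suc n)) < e) sequentially"
      using LIMSEQ_inverse_real_of_nat e(1) by (rule order_tendstoD)
    then show "\<forall>\<^sub>F n in sequentially. \<bar>(g (x + inverse (real (Suc n)) *\<^sub>R axis i 1) - g x) / inverse (real (Suc n))\<bar> \<le> L"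
    proof eventually_elim
      case (elim n)
      let ?r = "inverse (real (Suc n))"
      have r: "?r > 0" by simp
      have "dist x (x + ?r *\<^sub>R axis i 1) = ?r" using r by (simp add: dist_norm del: of_nat_Suc)
      then have "x + ?r *\<^sub>R axis i 1 \<in> ball x e" "x \<in> ball x e"
        using elim e(1) by (simp_all del: of_nat_Suc)
      then have "closed_segment (x + ?r *\<^sub>R axis i 1) x \<subseteq> \<Omega>"
        using closed_segment_subset[OF _ _ convex_ball] e(2) by (meson order_trans)
      from L[OF this] show ?case using r by (simp add: dist_norm abs_mult divide_simps del: of_nat_Suc)
    qed
  qed simp
  have *: "norm (grad g x) \<le> (\<Sum>i\<in>(UNIV::3 set). L)" if "x \<in> \<Omega>" "g differentiable at x" for x
    by (rule order_trans[OF norm_le_l1_cart sum_mono]) (rule bound[OF that])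
  have "AE x in lebesgue. x \<in> \<Omega> \<longrightarrow> g differentiable at x" using g by (simp add: admissible_def)
  then have "AE x in lebesgue. x \<in> \<Omega> \<longrightarrow> norm (grad g x) \<le> (\<Sum>i\<in>(UNIV::3 set). L)"
    by eventually_elim (use * in blast)
  then show ?thesis by (rule that)
qed

section \<open>Weak divergence of a scaled cross product of gradients\<close>

text \<open>From Lagrange's identity: the squares of the norm of the cross product and of the inner
  product add up to \<open>(norm x * norm y)\<^sup>2\<close>.\<close>

lemma norm_cross3_le: "norm (cross3 x y) \<le> norm x * norm y"
proof (rule power2_le_imp_le)
  show "(norm (cross3 x y))\<^sup>2 \<le> (norm x * norm y)\<^sup>2"
    using norm_cross_dot[of x y] zero_le_power2[of "x \<bullet> y"] by linarith
qed simp

lemma borel_measurable_cross3: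
  assumes "f \<in> borel_measurable M" "g \<in> borel_measurable M"
  shows "(\<lambda>x. cross3 (f x) (g x)) \<in> borel_measurable M"
  by (rule borel_measurable_continuous_Pair[OF assms])
    (intro continuous_on_cross continuous_intros)

lemma H_div_scaled_cross_grad:
  assumes \<Omega>: "open \<Omega>" "bounded \<Omega>"
    and f: "admissible \<Omega> f" and g: "admissible \<Omega> g" and h: "admissible \<Omega> h"
  shows "(\<lambda>x. f x *\<^sub>R cross3 (grad g x) (grad h x)) \<in> H_div \<Omega>"
proof -
  let ?c = "\<lambda>x. cross3 (grad g x) (grad h x)"
  let ?u = "\<lambda>x. f x *\<^sub>R cross3 (grad g x) (grad h x)"
  let ?d = "\<lambda>x. grad f x \<bullet> cross3 (grad g x) (grad h x)"
  have lm: "\<Omega> \<in> lmeasurable" using \<Omega> by (rule lmeasurable_open[OF _ , rotated])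
  have [measurable]: "grad f \<in> borel_measurable (lebesgue_on \<Omega>)"
    "grad g \<in> borel_measurable (lebesgue_on \<Omega>)" "grad h \<in> borel_measurable (lebesgue_on \<Omega>)"
    using admissible_grad_measurable f g h \<Omega>(1) by blast+
  have [measurable]: "f \<in> borel_measurable (lebesgue_on \<Omega>)"
    using f by (simp add: admissible_def measurable_completion measurable_restrict_space1)
  have [measurable]: "?c \<in> borel_measurable (lebesgue_on \<Omega>)"
    by (rule borel_measurable_cross3) measurable
  obtain A where A: "AE x in lebesgue. x \<in> \<Omega> \<longrightarrow> norm (grad f x) \<le> A"
    by (rule admissible_grad_bounded[OF f \<Omega>(1)])
  obtain B where B: "AE x in lebesgue. x \<in> \<Omega> \<longrightarrow> norm (grad g x) \<le> B"
    by (rule admissible_grad_bounded[OF g \<Omega>(1)])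
  obtain C where C: "AE x in lebesgue. x \<in> \<Omega> \<longrightarrow> norm (grad h x) \<le> C"
    by (rule admissible_grad_bounded[OF h \<Omega>(1)])
  obtain F where F: "\<And>x. \<bar>f x\<bar> \<le> F" using f unfolding admissible_def by metis
  have cb: "AE x in lebesgue. x \<in> \<Omega> \<longrightarrow> norm (?c x) \<le> B * C"
    using B C
  proof eventually_elim
    case (elim x)
    show ?case
    proof
      assume "x \<in> \<Omega>"
      then have "norm (grad g x) * norm (grad h x) \<le> B * C"
        using elim by (intro mult_mono order_trans[OF norm_ge_zero]) auto
      then show "norm (?c x) \<le> B * C" using norm_cross3_le order_trans by blast
    qed
  qed
  have "AE x in lebesgue. x \<in> \<Omega> \<longrightarrow> norm (?u x) \<le> F * (B * C)"
    using cb by eventually_elim (auto intro!: mult_mono F intro: order_trans[OF abs_ge_zero F])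
  then have u: "square_integrable_on ?u \<Omega>"
    using lm by (intro square_integrable_on_bounded[OF lm]) (auto simp: AE_restrict_space_iff)
  have "AE x in lebesgue. x \<in> \<Omega> \<longrightarrow> norm (?d x) \<le> A * (B * C)"
    using cb A
  proof eventually_elim
    case (elim x)
    show ?case
    proof
      assume x: "x \<in> \<Omega>"
      have "norm (?d x) \<le> norm (grad f x) * norm (?c x)" using Cauchy_Schwarz_ineq2 by simp
      also have "\<dots> \<le> A * (B * C)"
        using elim x by (intro mult_mono order_trans[OF norm_ge_zero]) auto
      finally show "norm (?d x) \<le> A * (B * C)" .
    qed
  qed
  then have d: "square_integrable_on ?d \<Omega>"
    using lm by (intro square_integrable_on_bounded[OF lm]) (auto simp: AE_restrict_space_iff)
  have "weak_divergence \<Omega> ?u ?d"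
    unfolding weak_divergence_def
  proof (intro allI impI)
    fix \<phi> assume \<phi>: "test_function \<Omega> \<phi>"
    obtain K where K: "compact K" "K \<subseteq> \<Omega>" "\<And>x. x \<notin> K \<Longrightarrow> \<phi> x = 0"
      using test_function_support[OF \<phi>] by metis
    have i1: "integrable (lebesgue_on \<Omega>) (\<lambda>x. ?u x \<bullet> grad \<phi> x)"
      by (intro square_integrable_on_inner u square_integrable_on_grad_test_function[OF \<phi> lm])
    have i2: "integrable (lebesgue_on \<Omega>) (\<lambda>x. ?d x * \<phi> x)"
      using square_integrable_on_inner[OF d square_integrable_on_test_function[OF \<phi> lm]] by simp
    \<comment> \<open>Only the first factor has to vanish outside a compact set; multiplying
      \<open>f\<close> by \<open>\<phi>\<close> achieves this, and \<open>g\<close> and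
      \<open>h\<close> stay as they are.\<close>
    have "0 = (LINT x|lebesgue_on \<Omega>. grad (\<lambda>x. f x * \<phi> x) x \<bullet> ?c x)"
      by (rule integral_jacobian_zero[symmetric, OF \<Omega>(1) K(1,2)])
        (use K(3) f g h admissible_mult admissible_test_function[OF \<phi>] in auto)
    also have "\<dots> = (LINT x|lebesgue_on \<Omega>. ?u x \<bullet> grad \<phi> x + ?d x * \<phi> x)"
    proof (rule integral_cong_AE)
      have "AE x in lebesgue. x \<in> \<Omega> \<longrightarrow> f differentiable at x" using f by (simp add: admissible_def)
      \<comment> \<open>The product rule splits the integrand, at each point where \<open>f\<close>
        is differentiable, into the two sides of the weak divergence identity.\<close>
      then have "AE x in lebesgue. x \<in> \<Omega> \<longrightarrow>
          grad (\<lambda>x. f x * \<phi> x) x \<bullet> ?c x = ?u x \<bullet> grad \<phi> x + ?d x * \<phi> x"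
        by eventually_elim
          (auto simp: grad_mult test_function_differentiable[OF \<phi>] inner_add_left inner_commute algebra_simps)
      then show "AE x in lebesgue_on \<Omega>. grad (\<lambda>x. f x * \<phi> x) x \<bullet> ?c x = ?u x \<bullet> grad \<phi> x + ?d x * \<phi> x"
        using lm by (simp add: AE_restrict_space_iff)
      have [measurable]: "grad (\<lambda>x. f x * \<phi> x) \<in> borel_measurable (lebesgue_on \<Omega>)"
        using admissible_grad_measurable[OF admissible_mult[OF f admissible_test_function[OF \<phi>]] \<Omega>(1)] .
      show "(\<lambda>x. grad (\<lambda>x. f x * \<phi> x) x \<bullet> ?c x) \<in> borel_measurable (lebesgue_on \<Omega>)" by measurable
      show "(\<lambda>x. ?u x \<bullet> grad \<phi> x + ?d x * \<phi> x) \<in> borel_measurable (lebesgue_on \<Omega>)"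
        using i1 i2 by (intro borel_measurable_add) auto
    qed
    also have "\<dots> = (LINT x|lebesgue_on \<Omega>. ?u x \<bullet> grad \<phi> x) + (LINT x|lebesgue_on \<Omega>. ?d x * \<phi> x)"
      by (rule Bochner_Integration.integral_add[OF i1 i2])
    finally show "(LINT x|lebesgue_on \<Omega>. ?u x \<bullet> grad \<phi> x) = - (LINT x|lebesgue_on \<Omega>. ?d x * \<phi> x)"
      by simp
  qed
  with u d show ?thesis unfolding H_div_def by blast
qed

section \<open>\<open>H_div\<close> as a linear space\<close>

text \<open>All integrals are over \<open>\<Omega>\<close> and the derivatives fall on the test
  function alone, so values of the field elsewhere are irrelevant. This later exchanges truncated
  hat functions for the original ones.\<close>

lemma H_div_transform:
  assumes "u \<in> H_div \<Omega>" "\<And>x. x \<in> \<Omega> \<Longrightarrow> u x = v x"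
  shows "v \<in> H_div \<Omega>"
proof -
  have 1: "square_integrable_on v \<Omega> \<longleftrightarrow> square_integrable_on u \<Omega>"
    unfolding square_integrable_on_def using assms(2)
    by (intro conj_cong measurable_cong Bochner_Integration.integrable_cong) auto
  have "(LINT x|lebesgue_on \<Omega>. v x \<bullet> grad \<phi> x) = (LINT x|lebesgue_on \<Omega>. u x \<bullet> grad \<phi> x)" for \<phi>
    using assms(2) by (intro Bochner_Integration.integral_cong) auto
  then show ?thesis using assms(1) 1 by (simp add: H_div_def weak_divergence_def)
qed

lemma H_div_add:
  assumes \<Omega>: "\<Omega> \<in> lmeasurable" and "u \<in> H_div \<Omega>" "v \<in> H_div \<Omega>"
  shows "(\<lambda>x. u x + v x) \<in> H_div \<Omega>"
proof -
  obtain d e where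
    ud: "square_integrable_on u \<Omega>" "square_integrable_on d \<Omega>" "weak_divergence \<Omega> u d" and
    ve: "square_integrable_on v \<Omega>" "square_integrable_on e \<Omega>" "weak_divergence \<Omega> v e"
    using assms by (auto simp: H_div_def)
  have "weak_divergence \<Omega> (\<lambda>x. u x + v x) (\<lambda>x. d x + e x)"
    unfolding weak_divergence_def
  proof (intro allI impI)
    fix \<phi> assume \<phi>: "test_function \<Omega> \<phi>"
    note s = square_integrable_on_test_function[OF \<phi> \<Omega>] square_integrable_on_grad_test_function[OF \<phi> \<Omega>]
    have i: "integrable (lebesgue_on \<Omega>) (\<lambda>x. u x \<bullet> grad \<phi> x)" "integrable (lebesgue_on \<Omega>) (\<lambda>x. v x \<bullet> grad \<phi> x)"
      "integrable (lebesgue_on \<Omega>) (\<lambda>x. d x * \<phi> x)" "integrable (lebesgue_on \<Omega>) (\<lambda>x. e x * \<phi> x)"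
      using square_integrable_on_inner[OF ud(1) s(2)] square_integrable_on_inner[OF ve(1) s(2)]
        square_integrable_on_inner[OF ud(2) s(1)] square_integrable_on_inner[OF ve(2) s(1)] by auto
    show "(LINT x|lebesgue_on \<Omega>. (u x + v x) \<bullet> grad \<phi> x) = - (LINT x|lebesgue_on \<Omega>. (d x + e x) * \<phi> x)"
      using ud(3) ve(3) \<phi> i by (simp add: weak_divergence_def inner_add_left distrib_right)
  qed
  then show ?thesis
    using square_integrable_on_add[OF ud(1) ve(1)] square_integrable_on_add[OF ud(2) ve(2)]
    unfolding H_div_def by blast
qed

lemma H_div_scaleR:
  assumes "u \<in> H_div \<Omega>"
  shows "(\<lambda>x. c *\<^sub>R u x) \<in> H_div \<Omega>"
proof -
  obtain d where
    ud: "square_integrable_on u \<Omega>" "square_integrable_on d \<Omega>" "weak_divergence \<Omega> u d"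
    using assms by (auto simp: H_div_def)
  have "weak_divergence \<Omega> (\<lambda>x. c *\<^sub>R u x) (\<lambda>x. c *\<^sub>R d x)"
    using ud(3) by (simp add: weak_divergence_def mult.assoc)
  then show ?thesis
    using square_integrable_on_scaleR[OF ud(1), of c] square_integrable_on_scaleR[OF ud(2), of c]
    unfolding H_div_def by blast
qed

lemma H_div_zero: "(\<lambda>x. 0) \<in> H_div \<Omega>"
  by (auto simp: H_div_def square_integrable_on_def weak_divergence_def intro!: exI[of _ "\<lambda>x. 0"])

lemma field_span_subset_H_div:
  assumes "\<Omega> \<in> lmeasurable" "S \<subseteq> H_div \<Omega>"
  shows "field_span S \<subseteq> H_div \<Omega>"
proof -
  interpret F: vector_space "\<lambda>(c::real) (f :: real^3 \<Rightarrow> real^3) x. c *\<^sub>R f x"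
    by (rule vector_space_fields)
  have "F.subspace (H_div \<Omega>)"
    unfolding F.subspace_def using assms(1)
    by (auto simp: H_div_add H_div_scaleR H_div_zero plus_fun_def zero_fun_def)
  then show ?thesis unfolding field_span_def using assms(2) by (rule F.span_minimal[rotated])
qed

section \<open>Hat functions\<close>

text \<open>The preimages of the sets under the parametrisation of the segment are finitely many
  closed sets covering \<open>{0..1}\<close>. On an interval, Lipschitz pieces on such a cover glue
  together without increasing the constant.\<close>

lemma lipschitz_on_segment_closed_Union:
  fixes f :: "'a::euclidean_space \<Rightarrow> real"
  assumes M: "finite M" "\<And>m. m \<in> M \<Longrightarrow> closed m" "\<And>m. m \<in> M \<Longrightarrow> L-lipschitz_on m f" "0 \<le> L"
    and s: "closed_segment p q \<subseteq> \<Union>M"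
  shows "\<bar>f p - f q\<bar> \<le> L * dist p q"
proof -
  let ?\<gamma> = "\<lambda>t. (1 - t) *\<^sub>R p + t *\<^sub>R q"
  have \<gamma>: "(dist q p)-lipschitz_on UNIV ?\<gamma>"
  proof (rule lipschitz_onI)
    fix s t :: real
    have "?\<gamma> s - ?\<gamma> t = (s - t) *\<^sub>R (q - p)" by (simp add: algebra_simps)
    then show "dist (?\<gamma> s) (?\<gamma> t) \<le> dist q p * dist s t"
      by (simp add: dist_norm)
  qed simp
  have "(L * dist q p)-lipschitz_on {0..1} (f \<circ> ?\<gamma>)"
  proof (rule lipschitz_on_closed_Union)
    show "(L * dist q p)-lipschitz_on (?\<gamma> -` m) (f \<circ> ?\<gamma>)" if "m \<in> M" for m
      by (rule lipschitz_on_compose[OF lipschitz_on_subset[OF \<gamma>] lipschitz_on_subset[OF M(3)[OF that]]]) auto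
    show "closed (?\<gamma> -` m)" if "m \<in> M" for m
      by (intro closed_vimage M that continuous_intros)
    show "{0..1} \<subseteq> (\<Union>m\<in>M. ?\<gamma> -` m)"
    proof
      fix t :: real assume "t \<in> {0..1}"
      then have "?\<gamma> t \<in> closed_segment p q" by (auto simp: closed_segment_def)
      then show "t \<in> (\<Union>m\<in>M. ?\<gamma> -` m)" using s by auto
    qed
  qed (use M in auto)
  \<comment> \<open>The endpoints are the parameters 0 and 1, at distance 1.\<close>
  from lipschitz_onD[OF this, of 0 1] show ?thesis
    by (simp add: dist_real_def dist_commute abs_minus_commute)
qed

text \<open>The frontier of a convex set is a null set.\<close>

lemma polytope_AE_interior:
  fixes m :: "(real^3) set"
  assumes "polytope m"
  shows "AE x in lebesgue. x \<in> m \<longrightarrow> x \<in> interior m"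
proof -
  have "negligible (frontier m)" using assms by (simp add: negligible_convex_frontier polytope_imp_convex)
  moreover have "{x. \<not> (x \<in> m \<longrightarrow> x \<in> interior m)} \<subseteq> frontier m"
    using closure_subset by (auto simp: frontier_def)
  ultimately show ?thesis unfolding eventually_ae_filter_negligible by blast
qed

section \<open>Regularity of hat functions on the mesh\<close>

context
  fixes M :: "(real^3) set set" and lam :: "(real^3) set \<Rightarrow> real^3 \<Rightarrow> real^3 \<Rightarrow> real"
  assumes mesh: "polyhedral_mesh M"
    and gbc: "\<And>m. m \<in> M \<Longrightarrow> gen_barycentric m (lam m)"
    and regular: "\<And>m. m \<in> M \<Longrightarrow> regular_coordinates m (lam m)"
    and agree: "agree_on_shared_faces M lam"
begin

private lemma mesh_polytope: "m \<in> M \<Longrightarrow> polytope m" and finite_mesh: "finite M"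
  using mesh by (auto simp: polyhedral_mesh_def)

private lemma hat_on_element:
  "m \<in> M \<Longrightarrow> x \<in> m \<Longrightarrow> hat M lam w x = (if w \<in> vertices m then lam m w x else 0)"
  by (rule hat_eq[OF mesh gbc agree])

lemma abs_hat_le_1:
  assumes "x \<in> \<Union>M"
  shows "\<bar>hat M lam w x\<bar> \<le> 1"
proof -
  obtain m where m: "m \<in> M" "x \<in> m" using assms by blast
  have fin: "finite (vertices m)"
    unfolding vertices_def
    by (rule finite_polyhedron_extreme_points[OF polytope_imp_polyhedron[OF mesh_polytope[OF m(1)]]])
  have nn: "\<forall>w\<in>vertices m. 0 \<le> lam m w x"
    and "\<And>a b. a + b \<bullet> x = (\<Sum>w\<in>vertices m. (a + b \<bullet> w) * lam m w x)"
    using gbc[OF m(1)] m(2) unfolding gen_barycentric_def by blast+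
  \<comment> \<open>Reproduction of the constant 1 makes the coordinates a partition of unity, so
    each nonnegative summand is at most 1.\<close>
  from this(2)[of 1 0] have "(\<Sum>w\<in>vertices m. lam m w x) = 1" by simp
  then have "lam m w x \<le> 1" if "w \<in> vertices m" using member_le_sum[OF that, of "\<lambda>w. lam m w x"] nn fin by simp
  then show ?thesis using nn hat_on_element[OF m] by auto
qed

lemma hat_lipschitz_on_elements:
  obtains L where "0 \<le> L" "\<And>m. m \<in> M \<Longrightarrow> L-lipschitz_on m (hat M lam w)"
proof -
  have "\<exists>C. C-lipschitz_on m (hat M lam w)" if m: "m \<in> M" for m
  proof (cases "w \<in> vertices m")
    case True
    then obtain C where "C-lipschitz_on m (lam m w)"
      using regular[OF m] unfolding regular_coordinates_def by blast
    then have "C-lipschitz_on m (hat M lam w)"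
      by (rule lipschitz_on_transform) (use True hat_on_element[OF m] in auto)
    then show ?thesis ..
  next
    case False
    then have "0-lipschitz_on m (hat M lam w)"
      using hat_on_element[OF m] by (intro lipschitz_onI) auto
    then show ?thesis ..
  qed
  then obtain C where C: "\<And>m. m \<in> M \<Longrightarrow> (C m)-lipschitz_on m (hat M lam w)" by metis
  have C0: "0 \<le> C m" if "m \<in> M" for m using C[OF that] by (rule lipschitz_on_nonneg)
  \<comment> \<open>The sum of the nonnegative elementwise constants serves as a common one, and is
    meaningful for an empty mesh too.\<close>
  have "(\<Sum>m\<in>M. C m)-lipschitz_on m (hat M lam w)" if "m \<in> M" for m
    using member_le_sum[OF that, of C] C0 finite_mesh by (intro lipschitz_on_mono[OF C[OF that] order_refl]) auto
  moreover have "0 \<le> (\<Sum>m\<in>M. C m)" using C0 by (rule sum_nonneg)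
  ultimately show ?thesis using that by blast
qed

text \<open>In the interior of an element the hat function is a coordinate of that element or zero,
  so differentiability is inherited there. The frontiers are null, and finitely many exceptional
  null sets are united.\<close>

lemma hat_AE_differentiable:
  "AE x in lebesgue. x \<in> \<Union>M \<longrightarrow> hat M lam w differentiable at x"
proof -
  have "AE x in lebesgue. x \<in> m \<longrightarrow> hat M lam w differentiable at x" if m: "m \<in> M" for m
  proof (cases "w \<in> vertices m")
    case True
    have "m \<in> sets lebesgue"
      using mesh_polytope[OF m] by (simp add: polytope_imp_compact lmeasurable_compact fmeasurableD)
    then have "AE x in lebesgue. x \<in> m \<longrightarrow> lam m w differentiable at x"
      using regular[OF m] True by (simp add: regular_coordinates_def AE_restrict_space_iff)
    with polytope_AE_interior[OF mesh_polytope[OF m]] show ?thesis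
    proof eventually_elim
      case (elim x)
      show ?case
      proof
        assume "x \<in> m"
        then have x: "x \<in> interior m" using elim by auto
        obtain D where "(lam m w has_derivative D) (at x)"
          using elim \<open>x \<in> m\<close> unfolding differentiable_def by blast
        then have "(hat M lam w has_derivative D) (at x)"
        proof (rule has_derivative_transform_within_open[OF _ open_interior x])
          show "lam m w y = hat M lam w y" if "y \<in> interior m" for y
            using hat_on_element[OF m, of y w] True subsetD[OF interior_subset that] by auto
        qed
        then show "hat M lam w differentiable at x" unfolding differentiable_def by blast
      qed
    qed
  next
    case False
    show ?thesis using polytope_AE_interior[OF mesh_polytope[OF m]]
    proof eventually_elim
      case (elim x)
      show ?case
      proof
        assume "x \<in> m"
        then have x: "x \<in> interior m" using elim by auto
        have "(hat M lam w has_derivative (\<lambda>h. 0)) (at x)"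
        proof (rule has_derivative_transform_within_open[OF has_derivative_const open_interior x])
          show "0 = hat M lam w y" if "y \<in> interior m" for y
            using hat_on_element[OF m, of y w] False subsetD[OF interior_subset that] by auto
        qed
        then show "hat M lam w differentiable at x" unfolding differentiable_def by blast
      qed
    qed
  qed
  then have "AE x in lebesgue. \<forall>m\<in>M. x \<in> m \<longrightarrow> hat M lam w differentiable at x"
    by (intro AE_finite_allI finite_mesh)
  then show ?thesis by eventually_elim blast
qed

text \<open>Outside the mesh \<open>hat\<close> is an unspecified choice, hence the truncation to the open domain.\<close>

lemma admissible_hat:
  "admissible (mesh_domain M) (\<lambda>x. indicator (mesh_domain M) x * hat M lam w x)"
proof -
  let ?\<Omega> = "mesh_domain M"
  let ?g = "\<lambda>x. indicator ?\<Omega> x * hat M lam w x"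
  have \<Omega>: "open ?\<Omega>" "?\<Omega> \<subseteq> \<Union>M" by (simp_all add: mesh_domain_def interior_subset)
  obtain L where L: "0 \<le> L" "\<And>m. m \<in> M \<Longrightarrow> L-lipschitz_on m (hat M lam w)"
    by (rule hat_lipschitz_on_elements) blast
  have lip: "\<bar>hat M lam w p - hat M lam w q\<bar> \<le> L * dist p q" if "closed_segment p q \<subseteq> ?\<Omega>" for p q
    by (rule lipschitz_on_segment_closed_Union[OF finite_mesh _ L(2) L(1)])
      (use that \<Omega>(2) mesh_polytope polytope_imp_closed in auto)
  \<comment> \<open>Pasting over the finitely many closed elements; continuity is used to obtain
    Borel measurability of the truncation.\<close>
  have "continuous_on (\<Union>M) (hat M lam w)"
    using finite_mesh mesh_polytope polytope_imp_closed lipschitz_on_continuous_on[OF L(2)]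
    by (intro continuous_on_closed_Union[where U="\<lambda>m. m", simplified]) auto
  then have "continuous_on ?\<Omega> (hat M lam w)" using \<Omega>(2) continuous_on_subset by blast
  then have "?g \<in> borel_measurable borel"
    using borel_measurable_continuous_on_indicator[of ?\<Omega> "hat M lam w"] \<Omega>(1) by simp
  moreover have "\<bar>?g x\<bar> \<le> 1" for x
    using abs_hat_le_1[of x w] \<Omega>(2) by (auto simp: indicator_def)
  moreover have "\<bar>?g p - ?g q\<bar> \<le> L * dist p q" if "closed_segment p q \<subseteq> ?\<Omega>" for p q
    using lip[OF that] that by (simp add: subset_iff)
  moreover have "AE x in lebesgue. x \<in> ?\<Omega> \<longrightarrow> ?g differentiable at x"
    using hat_AE_differentiable[of w]
  proof eventually_elim
    case (elim x)
    show ?case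
    proof
      assume x: "x \<in> ?\<Omega>"
      then obtain D where "(hat M lam w has_derivative D) (at x)"
        using elim \<Omega>(2) unfolding differentiable_def by blast
      then have "(?g has_derivative D) (at x)"
        by (rule has_derivative_transform_within_open[OF _ \<Omega>(1) x]) simp
      then show "?g differentiable at x" unfolding differentiable_def by blast
    qed
  qed
  ultimately show ?thesis unfolding admissible_def by blast
qed

text \<open>The truncated hat functions are admissible and give a field in \<open>H_div\<close>. On
  the open domain truncation changes neither values nor gradients, so the field agrees there with
  \<open>face_field\<close>.\<close>

lemma face_field_in_H_div: "face_field M lam w1 w2 w3 \<in> H_div (mesh_domain M)"
proof (rule H_div_transform)
  let ?\<Omega> = "mesh_domain M"
  let ?g = "\<lambda>w x. indicator ?\<Omega> x * hat M lam w x"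
  have \<Omega>: "open ?\<Omega>" "bounded ?\<Omega>"
    using finite_mesh mesh_polytope
    by (auto simp: mesh_domain_def polytope_imp_bounded intro!: bounded_interior bounded_Union)
  show "(\<lambda>x. ?g w1 x *\<^sub>R cross3 (grad (?g w2) x) (grad (?g w3) x)) \<in> H_div ?\<Omega>"
    by (intro H_div_scaled_cross_grad \<Omega> admissible_hat)
  have "grad (?g w) x = grad (hat M lam w) x" if "x \<in> ?\<Omega>" for w x
    by (rule grad_transform[OF \<Omega>(1) that]) simp
  then show "?g w1 x *\<^sub>R cross3 (grad (?g w2) x) (grad (?g w3) x) = face_field M lam w1 w2 w3 x"
    if "x \<in> ?\<Omega>" for x using that by (simp add: face_field_def)
qed

end

theorem theorem3p5:
  fixes M :: "(real^3) set set" and p :: nat and v :: "nat \<Rightarrow> real^3"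
    and lam :: "(real^3) set \<Rightarrow> real^3 \<Rightarrow> real^3 \<Rightarrow> real"
    and u :: "real^3 \<Rightarrow> real^3"
  assumes mesh: "polyhedral_mesh M"
    and ordering: "bij_betw v {1..p} (mesh_vertices M)"
    and gbc: "\<And>m. m \<in> M \<Longrightarrow> gen_barycentric m (lam m)"
    and regular: "\<And>m. m \<in> M \<Longrightarrow> regular_coordinates m (lam m)"
    and agree: "agree_on_shared_faces M lam"
    and u: "u \<in> field_span {face_field M lam (v i) (v j) (v k) | i j k.
              i \<in> {1..p} \<and> j \<in> {1..p} \<and> k \<in> {1..p} \<and>
              (\<exists>m\<in>M. v i \<in> vertices m \<and> v j \<in> vertices m \<and> v k \<in> vertices m)}"
  shows "u \<in> H_div (mesh_domain M)"
proof -
  have "bounded (\<Union>M)"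
    using mesh by (intro bounded_Union) (auto simp: polyhedral_mesh_def polytope_imp_bounded)
  \<comment> \<open>Finite measure makes test functions square integrable, which is used to split
    integrals when adding fields in \<open>H_div\<close>.\<close>
  then have "mesh_domain M \<in> lmeasurable"
    unfolding mesh_domain_def by (intro lmeasurable_open bounded_interior open_interior)
  with u show ?thesis
    by (rule subsetD[OF field_span_subset_H_div, rotated 2])
      (use face_field_in_H_div[OF mesh gbc regular agree] in auto)
qed

end
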